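(* Let $n,d\ge 1$ and $t\ge 0$ be integers with $n>\max\{3,d+1\}\cdot t$. For $n$ clients with vectors in $\mathbb{R}^d$, up to $t$ of which are Byzantine, consider the algorithm that outputs a vector contained in the safe area that minimizes the distance to the center of the minimum covering ball $\mathrm{Ball_{cov}}(S_{\mathrm{Cent}})$. This algorithm computes a $2d$-approximation of the centroid.
   Context: Model. There are $n$ clients, up to $t$ of which are Byzantine, and one trusted server. The server receives a family of $m$ vectors $(v_i)_{i\in M}$ in $\mathbb{R}^d$ (Euclidean norm and distance $\mathrm{dist}$), where $M\subseteq\{1,\dots,n\}$, $|M|=m$, $n-t\le m\le n$. An unknown set $N\subseteq M$ with $|N|\ge n-t$ is the set of non-faulty clients; the vectors of the clients in $M\setminus N$ are Byzantine and arbitrary. An aggregation algorithm is a deterministic function of the received family only (it does not know $N$); its output is a vector in $\mathbb{R}^d$. A received family together with an admissible set $N$ is called a configuration. True centroid: $\mathrm{Cent}^\star=\frac1{|N|}\sum_{i\in N}v_i$. Candidate centroids: $S_{\mathrm{Cent}}$ is the set of all averages $\frac{1}{n-t}\sum_{i\in I}v_i$ with $I\subseteq M$, $|I|=n-t$. The minimum covering ball $\mathrm{Ball_{cov}}(S_{\mathrm{Cent}})$ is the smallest closed Euclidean ball containing $S_{\mathrm{Cent}}$, and $\mathrm{Rad_{cov}}$ is its radius. Approximation: an algorithm computes an $\alpha$-approximation of the centroid if, in every configuration, its output $O$ satisfies $\mathrm{dist}(O,\mathrm{Cent}^\star)\le\alpha\cdot\mathrm{Rad_{cov}}$. Safe area: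 the intersection $\bigcap_{I}\mathrm{Conv}\{v_i: i\in I\}$ over all subsets $I\subseteq M$ of size $n-t$ (non-empty when $n>\max\{3,d+1\}\cdot t$). *)

theory Defs
  imports "HOL-Analysis.Analysis"
begin

text \<open>
  A received family \<open>(v\<^sub>i)\<^sub>i\<^sub>\<in>\<^sub>M\<close> is given by its index set \<open>M\<close> together with a function \<open>v\<close> that is
  \<open>undefined\<close> outside \<open>M\<close> (\<open>extensional\<close>). Hence an aggregation algorithm, modelled as a function
  of \<open>M\<close> and \<open>v\<close>, has access to the received vectors only, and not to the set of non-faulty clients.
\<close>

type_synonym 'a aggregation = "nat set \<Rightarrow> (nat \<Rightarrow> 'a) \<Rightarrow> 'a"

text \<open>
  All natural-number subtractions \<open>n - t\<close> below are intended for \<open>t \<le> n\<close>.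
\<close>

definition received_family :: "nat \<Rightarrow> nat \<Rightarrow> nat set \<Rightarrow> (nat \<Rightarrow> 'a) \<Rightarrow> bool" where
  "received_family n t M v \<longleftrightarrow>
     M \<subseteq> {1..n} \<and> n - t \<le> card M \<and> card M \<le> n \<and> v \<in> extensional M"

definition configuration :: "nat \<Rightarrow> nat \<Rightarrow> nat set \<Rightarrow> (nat \<Rightarrow> 'a) \<Rightarrow> nat set \<Rightarrow> bool" where
  "configuration n t M v N \<longleftrightarrow>
     received_family n t M v \<and> N \<subseteq> M \<and> n - t \<le> card N"

definition centroid :: "(nat \<Rightarrow> 'a::real_vector) \<Rightarrow> nat set \<Rightarrow> 'a" where
  "centroid v I = (1 / real (card I)) *\<^sub>R (\<Sum>i\<in>I. v i)"

definition candidate_centroids ::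
    "nat \<Rightarrow> nat \<Rightarrow> nat set \<Rightarrow> (nat \<Rightarrow> 'a::real_vector) \<Rightarrow> 'a set" where
  "candidate_centroids n t M v = {centroid v I | I. I \<subseteq> M \<and> card I = n - t}"

definition is_min_covering_ball :: "'a::metric_space set \<Rightarrow> 'a \<Rightarrow> real \<Rightarrow> bool" where
  "is_min_covering_ball S c r \<longleftrightarrow>
     0 \<le> r \<and> S \<subseteq> cball c r \<and> (\<forall>c' r'. 0 \<le> r' \<and> S \<subseteq> cball c' r' \<longrightarrow> r \<le> r')"

text \<open>
  A non-empty bounded subset of a Euclidean space has exactly one minimum covering ball, so the
  descriptions below are proper for the finite non-empty sets they are applied to.
\<close>

definition covering_center :: "'a::metric_space set \<Rightarrow> 'a" where
  "covering_center S = (THE c. \<exists>r. is_min_covering_ball S c r)"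

definition covering_radius :: "'a::metric_space set \<Rightarrow> real" where
  "covering_radius S = (THE r. \<exists>c. is_min_covering_ball S c r)"

definition safe_area ::
    "nat \<Rightarrow> nat \<Rightarrow> nat set \<Rightarrow> (nat \<Rightarrow> 'a::real_vector) \<Rightarrow> 'a set" where
  "safe_area n t M v = (\<Inter>I \<in> {I. I \<subseteq> M \<and> card I = n - t}. convex hull (v ` I))"

text \<open>
  \<open>closest_point S a\<close> is a point of \<open>S\<close> at minimal distance from \<open>a\<close>. The safe area is closed and
  convex, so that this point is unique whenever the safe area is non-empty.
\<close>

definition safe_area_algorithm :: "nat \<Rightarrow> nat \<Rightarrow> 'a::euclidean_space aggregation" where
  "safe_area_algorithm n t M v =
     closest_point (safe_area n t M v) (covering_center (candidate_centroids n t M v))"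

definition computes_centroid_approximation ::
    "nat \<Rightarrow> nat \<Rightarrow> real \<Rightarrow> 'a::real_normed_vector aggregation \<Rightarrow> bool" where
  "computes_centroid_approximation n t \<alpha> A \<longleftrightarrow>
     (\<forall>M v N. configuration n t M v N \<longrightarrow>
        dist (A M v) (centroid v N) \<le> \<alpha> * covering_radius (candidate_centroids n t M v))"

end

theory Submission
  imports Defs
begin

text \<open>
  Let \<open>k = n - t\<close>, \<open>s = |M| - k\<close> and let \<open>c\<close>, \<open>R\<close> be the centre and radius of the covering ball.
  The true centroid is an average of candidate centroids, so it has distance at most \<open>R\<close> from \<open>c\<close>.
  It remains to find a point of the safe area at distance at most \<open>(2 d - 1) R\<close> from \<open>c\<close>. By Helly's
  theorem it suffices that any \<open>d + 1\<close> of the convex hulls have a common point, which holds since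
  any \<open>d + 1\<close> index sets of size \<open>k\<close> share an index, and that any \<open>d\<close> of them have a common point
  within that distance of \<open>c\<close>. Any \<open>d\<close> index sets share a set \<open>J\<close> of size \<open>k - (d - 1) s\<close>.
  Averaging the candidate centroids of the \<open>I \<supseteq> J\<close> gives a point \<open>p\<close>, and averaging those of the
  \<open>I \<supseteq> M - J\<close> gives a point \<open>q\<close>, both in the covering ball. The centroid of \<open>J\<close> is
  \<open>d p - (d - 1) q = p + (d - 1) (p - q)\<close>, hence at distance at most \<open>R + (d - 1) 2 R\<close> from \<open>c\<close>.
\<close>

section \<open>The minimum covering ball\<close>

text \<open>The pairs of centre and radius of covering balls form a closed set. Capping the radius
  at that of one covering ball makes it bounded, as every centre then stays within \<open>r0\<close>
  of a fixed point of \<open>S\<close>. By compactness the radius attains its minimum.\<close>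

lemma min_covering_ball_exists:
  fixes S :: "'a::euclidean_space set"
  assumes "bounded S" "S \<noteq> {}"
  shows "\<exists>c r. is_min_covering_ball S c r"
proof -
  obtain c0 r0 where c0: "S \<subseteq> cball c0 r0"
    using assms(1) by (meson bounded_subset_cball)
  obtain s0 where s0: "s0 \<in> S"
    using assms(2) by blast
  define P where "P = {x :: 'a \<times> real. \<forall>s\<in>S. dist (fst x) s \<le> snd x} \<inter> {x. snd x \<le> r0}"
  have "closed P"
  proof -
    have "P = (\<Inter>s\<in>S. {x :: 'a \<times> real. dist (fst x) s \<le> snd x}) \<inter> {x. snd x \<le> r0}"
      by (auto simp: P_def)
    then show ?thesis
      by (auto intro!: closed_INT closed_Collect_le closed_Int continuous_intros)
  qed
  moreover have "P \<subseteq> cball s0 r0 \<times> {0..r0}"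
  proof
    fix x assume x: "x \<in> P"
    have "dist (fst x) s0 \<le> snd x" "snd x \<le> r0"
      using x s0 by (auto simp: P_def)
    moreover from this have "0 \<le> snd x"
      using zero_le_dist[of "fst x" s0] by linarith
    ultimately show "x \<in> cball s0 r0 \<times> {0..r0}"
      by (cases x) (simp add: dist_commute)
  qed
  moreover have "bounded (cball s0 r0 \<times> {0..r0})"
    by (intro bounded_Times bounded_cball bounded_closed_interval)
  ultimately have "compact P"
    using bounded_subset compact_eq_bounded_closed by blast
  moreover have "(c0, r0) \<in> P"
    using c0 by (auto simp: P_def)
  moreover have "continuous_on P snd"
    by (intro continuous_intros)
  ultimately obtain x where x: "x \<in> P" and le: "\<And>y. y \<in> P \<Longrightarrow> snd x \<le> snd y"
    using continuous_attains_inf[of P snd] by blast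
  have "is_min_covering_ball S (fst x) (snd x)"
    unfolding is_min_covering_ball_def
  proof (intro conjI allI impI)
    have "dist (fst x) s0 \<le> snd x"
      using x s0 by (auto simp: P_def)
    then show "0 \<le> snd x"
      using zero_le_dist[of "fst x" s0] by linarith
    show "S \<subseteq> cball (fst x) (snd x)"
      using x by (auto simp: P_def)
    fix c' r' assume *: "0 \<le> r' \<and> S \<subseteq> cball c' r'"
    show "snd x \<le> r'"
    proof (cases "r' \<le> r0")
      case True
      then have "(c', r') \<in> P"
        using * by (auto simp: P_def)
      then show ?thesis
        using le by fastforce
    next
      case False
      then show ?thesis
        using x by (auto simp: P_def)
    qed
  qed
  then show ?thesis
    by blast
qed

lemma min_covering_ball_radius_unique:
  "is_min_covering_ball S c r \<Longrightarrow> is_min_covering_ball S c' r' \<Longrightarrow> r = r'"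
  unfolding is_min_covering_ball_def by (meson order_antisym)

text \<open>By the parallelogram law, the midpoint of two centres would admit a smaller ball.\<close>

lemma min_covering_ball_center_unique:
  fixes S :: "'a::euclidean_space set"
  assumes "S \<noteq> {}" "is_min_covering_ball S c r" "is_min_covering_ball S c' r'"
  shows "c = c'"
proof -
  have r': "r' = r"
    using min_covering_ball_radius_unique assms(2,3) by metis
  have r0: "0 \<le> r" and S: "S \<subseteq> cball c r" "S \<subseteq> cball c' r"
    and least: "\<And>c' r'. 0 \<le> r' \<Longrightarrow> S \<subseteq> cball c' r' \<Longrightarrow> r \<le> r'"
    using assms(2,3) unfolding is_min_covering_ball_def r' by auto
  let ?m = "midpoint c c'"
  \<comment> \<open>The square of a radius that suffices around the midpoint; minimality of
    \<open>r\<close> then forces \<open>dist c c' = 0\<close>.\<close>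
  let ?e = "r\<^sup>2 - (dist c c')\<^sup>2 / 4"
  have bound: "(dist ?m x)\<^sup>2 \<le> ?e" if "x \<in> S" for x
  proof -
    have "(dist c x)\<^sup>2 \<le> r\<^sup>2" "(dist c' x)\<^sup>2 \<le> r\<^sup>2"
      using S that by (auto intro!: power_mono)
    moreover have "(dist ?m x)\<^sup>2 = ((dist c x)\<^sup>2 + (dist c' x)\<^sup>2) / 2 - (dist c c')\<^sup>2 / 4"
      unfolding dist_norm midpoint_def power2_norm_eq_inner
      by (simp add: inner_simps inner_commute field_simps)
    ultimately show ?thesis
      by simp
  qed
  obtain x where "x \<in> S"
    using assms(1) by blast
  then have "0 \<le> ?e"
    using bound zero_le_power2 order_trans by blast
  moreover have "S \<subseteq> cball ?m (sqrt ?e)"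
    using bound by (auto intro!: real_le_rsqrt)
  ultimately have "r \<le> sqrt ?e"
    by (intro least) auto
  then have "r\<^sup>2 \<le> ?e"
    using r0 \<open>0 \<le> ?e\<close> by (metis power_mono real_sqrt_pow2)
  then show ?thesis
    by simp
qed

lemma is_min_covering_ball_covering:
  fixes S :: "'a::euclidean_space set"
  assumes "bounded S" "S \<noteq> {}"
  shows "is_min_covering_ball S (covering_center S) (covering_radius S)"
proof -
  obtain c r where cr: "is_min_covering_ball S c r"
    using min_covering_ball_exists[OF assms] by blast
  have "covering_center S = c"
    unfolding covering_center_def
    using cr min_covering_ball_center_unique[OF assms(2)] by blast
  moreover have "covering_radius S = r"
    unfolding covering_radius_def
    using cr min_covering_ball_radius_unique by blast
  ultimately show ?thesis
    using cr by simp
qed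

section \<open>Averages over subsets of fixed size\<close>

text \<open>The point in question is the average of \<open>sum v I\<close> over all \<open>I \<subseteq> N\<close> of size \<open>k\<close>.\<close>

lemma scaled_sum_in_convex:
  fixes v :: "'i \<Rightarrow> 'a::real_vector"
  assumes "convex C" "finite N" "k \<le> card N"
    and "\<And>I. I \<subseteq> N \<Longrightarrow> card I = k \<Longrightarrow> sum v I \<in> C"
  shows "(real k / real (card N)) *\<^sub>R sum v N \<in> C"
  using assms(2-4)
proof (induction "card N" arbitrary: N)
  case 0
  then show ?case
    using 0(4)[of "{}"] by simp
next
  case (Suc l)
  show ?case
  proof (cases "k = Suc l")
    case True
    then show ?thesis
      using Suc.prems(3)[of N] Suc.hyps(2) by simp
  next
    case False
    then have kl: "k \<le> l"
      using Suc by simp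
    have card: "card (N - {i}) = l" if "i \<in> N" for i
      using that Suc.hyps(2) Suc.prems(1) by simp
    have mem: "(real k / real l) *\<^sub>R sum v (N - {i}) \<in> C" if "i \<in> N" for i
      using Suc.hyps(1)[of "N - {i}"] Suc.prems card[OF that] kl by auto
    \<comment> \<open>The induction hypothesis is averaged over the removed element
      \<open>i\<close>; each index survives in \<open>l\<close> of the \<open>Suc l\<close>
      sums.\<close>
    have "(\<Sum>i\<in>N. (1 / real (Suc l)) *\<^sub>R ((real k / real l) *\<^sub>R sum v (N - {i}))) \<in> C"
      using Suc.hyps(2) Suc.prems(1) mem by (intro convex_sum assms(1)) auto
    moreover have "(\<Sum>i\<in>N. sum v (N - {i})) = real l *\<^sub>R sum v N"
    proof -
      have "(\<Sum>i\<in>N. sum v (N - {i})) = (\<Sum>i\<in>N. sum v N - v i)"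
        using Suc.prems(1) by (simp add: sum_diff1)
      also have "\<dots> = real (card N) *\<^sub>R sum v N - sum v N"
        by (simp add: sum_subtractf sum_constant_scaleR)
      finally show ?thesis
        using Suc.hyps(2)[symmetric] by (simp add: algebra_simps)
    qed
    ultimately have "((1 / real (Suc l)) * (real k / real l) * real l) *\<^sub>R sum v N \<in> C"
      by (simp add: scaleR_sum_right[symmetric])
    \<comment> \<open>For \<open>l = 0\<close> also \<open>k = 0\<close>, so both coefficients
      vanish; otherwise \<open>l\<close> cancels.\<close>
    then show ?thesis
      using Suc.hyps(2)[symmetric] kl by (cases "l = 0") auto
  qed
qed

lemma centroid_in_convex_hull:
  assumes "finite I" "I \<noteq> {}"
  shows "centroid v I \<in> convex hull (v ` I)"
proof -
  have "(\<Sum>i\<in>I. (1 / real (card I)) *\<^sub>R v i) \<in> convex hull (v ` I)"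
    using assms by (intro convex_sum) (auto intro: hull_inc)
  then show ?thesis
    by (simp add: centroid_def scaleR_sum_right)
qed

text \<open>With \<open>c' = k c\<close> and \<open>r' = k R\<close>, sums instead of averages are kept in the ball.\<close>

lemma dist_scaled_sum_le:
  fixes v :: "'i \<Rightarrow> 'a::euclidean_space"
  assumes "finite M" "J \<subseteq> M" "J \<noteq> {}" "0 < d"
    and J: "card J + (d - 1) * s = k" and M: "card M = k + s" and s: "s \<le> card J"
    and ball: "\<And>I. I \<subseteq> M \<Longrightarrow> card I = k \<Longrightarrow> sum v I \<in> cball c' r'"
  shows "dist ((real k / real (card J)) *\<^sub>R sum v J) c' \<le> (2 * real d - 1) * r'"
proof -
  define B where "B = M - J"
  have fin: "finite J" "finite B" "J \<inter> B = {}"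
    using assms finite_subset by (auto simp: B_def)
  have "card B = card M - card J"
    unfolding B_def using assms fin by (simp add: card_Diff_subset)
  then have cardB: "card B = d * s"
    using J M \<open>0 < d\<close> by (cases d) auto
  have cardJ: "0 < card J"
    using fin assms by (simp add: card_gt_0_iff)
  \<comment> \<open>Translating the ball absorbs a fixed summand, so that only the varying part of
    an index set is averaged.\<close>
  have shift: "x \<in> cball (c' - a) r' \<longleftrightarrow> a + x \<in> cball c' r'" for a x
    by (simp add: dist_norm algebra_simps)
  \<comment> \<open>\<open>p\<close> averages \<open>sum v (J \<union> I)\<close> over the
    \<open>I \<subseteq> B\<close> of size \<open>(d - 1) * s\<close>, and \<open>q\<close> averages
    \<open>sum v (B \<union> I)\<close> over the \<open>I \<subseteq> J\<close> of size
    \<open>card J - s\<close>. All these index sets have size \<open>k\<close>.\<close>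
  define p where "p = sum v J + (real ((d - 1) * s) / real (card B)) *\<^sub>R sum v B"
  define q where "q = sum v B + (real (card J - s) / real (card J)) *\<^sub>R sum v J"
  have p: "p \<in> cball c' r'"
    unfolding p_def shift[symmetric]
  proof (rule scaled_sum_in_convex)
    fix I assume I: "I \<subseteq> B" "card I = (d - 1) * s"
    then have "finite I" "J \<inter> I = {}"
      using fin finite_subset by auto
    then have "sum v (J \<union> I) = sum v J + sum v I" "card (J \<union> I) = k"
      using fin I J by (simp_all add: sum.union_disjoint card_Un_disjoint)
    moreover have "J \<union> I \<subseteq> M"
      using I \<open>J \<subseteq> M\<close> by (auto simp: B_def)
    ultimately show "sum v I \<in> cball (c' - sum v J) r'"
      unfolding shift using ball by metis
  qed (use fin cardB in auto)
  have q: "q \<in> cball c' r'"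
    unfolding q_def shift[symmetric]
  proof (rule scaled_sum_in_convex)
    fix I assume I: "I \<subseteq> J" "card I = card J - s"
    then have "finite I" "B \<inter> I = {}"
      using fin finite_subset by auto
    moreover have "d * s + (card J - s) = k"
      using J s \<open>0 < d\<close> by (cases d) auto
    ultimately have "sum v (B \<union> I) = sum v B + sum v I" "card (B \<union> I) = k"
      using fin I cardB by (simp_all add: sum.union_disjoint card_Un_disjoint)
    moreover have "B \<union> I \<subseteq> M"
      using I \<open>J \<subseteq> M\<close> by (auto simp: B_def)
    ultimately show "sum v I \<in> cball (c' - sum v B) r'"
      unfolding shift using ball by metis
  qed (use fin in auto)
  \<comment> \<open>The weights \<open>d\<close> and \<open>-(d - 1)\<close> add up to 1 and cancel
    \<open>sum v B\<close>: its coefficient in \<open>p\<close> is \<open>(d - 1) / d\<close> if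
    \<open>s > 0\<close>, and \<open>B\<close> is empty if \<open>s = 0\<close>.\<close>
  have "real d *\<^sub>R p - (real d - 1) *\<^sub>R q
      = (real d - (real d - 1) * (real (card J - s) / real (card J))) *\<^sub>R sum v J
        + (real d * (real ((d - 1) * s) / real (card B)) - (real d - 1)) *\<^sub>R sum v B"
    by (simp add: p_def q_def algebra_simps)
  also have "(real d * (real ((d - 1) * s) / real (card B)) - (real d - 1)) *\<^sub>R sum v B = 0"
  proof (cases "s = 0")
    case True
    then show ?thesis
      using cardB fin by simp
  next
    case False
    then show ?thesis
      using \<open>0 < d\<close> by (simp add: cardB of_nat_diff)
  qed
  also have "real d - (real d - 1) * (real (card J - s) / real (card J)) = real k / real (card J)"
    using J[symmetric] s \<open>0 < d\<close> cardJ by (simp add: of_nat_diff field_simps)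
  finally have eq: "(real k / real (card J)) *\<^sub>R sum v J - c'
      = (p - c') + (real d - 1) *\<^sub>R ((p - c') - (q - c'))"
    by (simp add: algebra_simps)
  have np: "norm (p - c') \<le> r'" and nq: "norm (q - c') \<le> r'"
    using p q by (auto simp: dist_norm norm_minus_commute)
  have "norm ((p - c') - (q - c')) \<le> 2 * r'"
    using norm_triangle_ineq4[of "p - c'" "q - c'"] np nq by linarith
  then have "norm ((real d - 1) *\<^sub>R ((p - c') - (q - c'))) \<le> (real d - 1) * (2 * r')"
    using \<open>0 < d\<close> by (auto intro!: mult_left_mono)
  then show ?thesis
    using norm_triangle_ineq[of "p - c'" "(real d - 1) *\<^sub>R ((p - c') - (q - c'))"] np
    unfolding dist_norm eq by (simp add: algebra_simps)
qed

section \<open>Points of the safe area near the centre\<close>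

text \<open>Testing all subfamilies of at most \<open>DIM('a) + 1\<close> members dispenses with a
  lower bound on \<open>card F\<close>, since a small \<open>F\<close> is itself tested. Infinite
  families have \<open>card\<close> 0 and thus count as small.\<close>

lemma Helly_card_le:
  fixes F :: "'a::euclidean_space set set"
  assumes "\<And>S. S \<in> F \<Longrightarrow> convex S"
    and "\<And>G. G \<subseteq> F \<Longrightarrow> card G \<le> DIM('a) + 1 \<Longrightarrow> \<Inter>G \<noteq> {}"
  shows "\<Inter>F \<noteq> {}"
proof (cases "card F \<le> DIM('a) + 1")
  case True
  then show ?thesis
    using assms(2) by blast
next
  case False
  show ?thesis
  proof (rule Helly)
    show "DIM('a) + 1 \<le> card F"
      using False by simp
    show "\<forall>S\<in>F. convex S"
      using assms(1) by blast
    show "\<Inter>G \<noteq> {}" if "G \<subseteq> F" "card G = DIM('a) + 1" for G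
      using assms(2) that by simp
  qed
qed

text \<open>Each member of \<open>K\<close> misses at most \<open>s\<close> elements of
  \<open>M\<close>, so together they miss at most \<open>card K * s\<close>. Intersecting with
  \<open>M\<close> gives the empty \<open>K\<close> its proper meaning.\<close>

lemma card_Inter_ge:
  assumes "finite M" "finite K" "\<And>I. I \<in> K \<Longrightarrow> I \<subseteq> M \<and> card M \<le> card I + s"
  shows "card M \<le> card (M \<inter> \<Inter>K) + card K * s"
  using assms(2,3)
proof (induction K)
  case empty
  then show ?case by simp
next
  case (insert I K)
  have fin: "finite I"
    using insert.prems assms(1) finite_subset by blast
  have "card (M \<inter> \<Inter>K) + card I = card (M \<inter> \<Inter>K \<union> I) + card (M \<inter> \<Inter>K \<inter> I)"
    using fin assms(1) by (intro card_Un_Int) auto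
  moreover have "card (M \<inter> \<Inter>K \<union> I) \<le> card M"
    using insert.prems assms(1) by (intro card_mono) auto
  moreover have "M \<inter> \<Inter>K \<inter> I = M \<inter> \<Inter>(insert I K)"
    by auto
  moreover have "card M \<le> card I + s"
    using insert.prems by auto
  moreover have "card M \<le> card (M \<inter> \<Inter>K) + card K * s"
    using insert by auto
  ultimately show ?case
    using insert.hyps by simp
qed

text \<open>Helly's theorem is applied to the hulls together with one more convex set, the ball
  \<open>D\<close> of the claimed radius about \<open>c\<close>.\<close>

lemma safe_area_point_near_center:
  fixes v :: "nat \<Rightarrow> 'a::euclidean_space"
  assumes "finite M" and M: "card M = k + s" and k: "DIM('a) * s < k" "k = n - t"
    and ball: "candidate_centroids n t M v \<subseteq> cball c r"
  shows "\<exists>x \<in> safe_area n t M v. dist c x \<le> (2 * real DIM('a) - 1) * r"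
proof -
  let ?d = "DIM('a)"
  let ?Is = "{I. I \<subseteq> M \<and> card I = k}"
  let ?h = "\<lambda>I. convex hull (v ` I)"
  define D where "D = cball c ((2 * real ?d - 1) * r)"
  have k0: "0 < k"
    using k by simp
  have ball': "sum v I \<in> cball (real k *\<^sub>R c) (real k * r)" if "I \<subseteq> M" "card I = k" for I
  proof -
    have "centroid v I \<in> cball c r"
      using that k(2) by (intro subsetD[OF ball]) (auto simp: candidate_centroids_def)
    moreover have "real k *\<^sub>R c - sum v I = real k *\<^sub>R (c - centroid v I)"
      using that k0 by (simp add: centroid_def algebra_simps)
    ultimately show ?thesis
      using k0 by (simp add: dist_norm)
  qed
  have "\<Inter>(insert D (?h ` ?Is)) \<noteq> {}"
  proof (rule Helly_card_le)
    fix S assume "S \<in> insert D (?h ` ?Is)"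
    then show "convex S"
      by (auto simp: D_def)
  next
    fix G assume G: "G \<subseteq> insert D (?h ` ?Is)" "card G \<le> ?d + 1"
    have finG: "finite G"
      using G(1) assms(1) by (auto intro: finite_subset)
    \<comment> \<open>Different index sets may have the same hull; choosing one per hull lets
      \<open>card G\<close> bound the number of index sets.\<close>
    obtain K where K: "K \<subseteq> ?Is" "finite K" "inj_on ?h K" "?h ` K = G - {D}"
    proof -
      have "G - {D} \<subseteq> ?h ` ?Is"
        using G(1) by auto
      then obtain K where K: "K \<subseteq> ?Is" "inj_on ?h K" "G - {D} = ?h ` K"
        by (meson subset_image_inj)
      have "finite K"
        using K(1) assms(1) by (auto intro: finite_subset[of K "Pow M"])
      then show ?thesis
        using that[OF K(1) _ K(2) K(3)[symmetric]] by blast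
    qed
    have cardK: "card K = card (G - {D})"
      using K by (metis card_image)
    let ?J = "M \<inter> \<Inter>K"
    have J: "k + s \<le> card ?J + card K * s"
      unfolding M[symmetric] using K(1) M assms(1) by (intro card_Inter_ge K(2)) auto
    have hull: "?h A \<subseteq> \<Inter>(G - {D})" if "A \<subseteq> ?J" for A
      unfolding K(4)[symmetric] by (intro INT_greatest hull_mono image_mono) (use that in blast)
    show "\<Inter>G \<noteq> {}"
    proof (cases "D \<in> G")
      case False
      then have "card K * s \<le> (?d + 1) * s"
        using cardK G(2) by (intro mult_right_mono) auto
      \<comment> \<open>At most \<open>d + 1\<close> index sets share at least
        \<open>k - d * s > 0\<close> indices.\<close>
      then have "card ?J \<noteq> 0"
        using J k by auto
      then obtain i where "i \<in> ?J"
        by (metis card.empty ex_in_conv)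
      then have "v i \<in> \<Inter>(G - {D})"
        using hull[of "{i}"] by auto
      then show ?thesis
        using False by auto
    next
      case True
      \<comment> \<open>Apart from \<open>D\<close>, at most \<open>d\<close> hulls remain.\<close>
      then have "card K \<le> ?d"
        using cardK G(2) finG by simp
      then have "card K * s \<le> ?d * s"
        by (rule mult_right_mono) simp
      moreover have ds: "?d * s = (?d - 1) * s + s"
        using DIM_positive[where 'a='a] by (cases ?d) auto
      ultimately have "k - (?d - 1) * s \<le> card ?J"
        using J by simp
      \<comment> \<open>The distance estimate needs exactly this size, which exceeds
        \<open>s\<close> because \<open>d * s < k\<close>.\<close>
      then obtain A where A: "A \<subseteq> ?J" "card A = k - (?d - 1) * s"
        by (meson obtain_subset_with_card_n)
      have cardA: "card A + (?d - 1) * s = k" "s \<le> card A" "0 < card A"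
        using A(2) ds k by simp_all
      then have finA: "finite A" "A \<noteq> {}"
        using card_gt_0_iff by blast+
      have "dist ((real k / real (card A)) *\<^sub>R sum v A) (real k *\<^sub>R c)
          \<le> (2 * real ?d - 1) * (real k * r)"
        using A finA cardA assms(1) M ball'
        by (intro dist_scaled_sum_le[of M]) auto
      also have "dist ((real k / real (card A)) *\<^sub>R sum v A) (real k *\<^sub>R c)
          = real k * dist c (centroid v A)"
      proof -
        have "(real k / real (card A)) *\<^sub>R sum v A - real k *\<^sub>R c
            = real k *\<^sub>R (centroid v A - c)"
          by (simp add: centroid_def algebra_simps)
        then show ?thesis
          by (simp add: dist_norm norm_minus_commute)
      qed
      finally have "centroid v A \<in> D"
        using k0 by (simp add: D_def mult.left_commute)
      moreover have "centroid v A \<in> \<Inter>(G - {D})"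
        using hull[OF A(1)] centroid_in_convex_hull[OF finA] by blast
      ultimately show ?thesis
        by blast
    qed
  qed
  then show ?thesis
    by (auto simp: safe_area_def k(2) D_def)
qed

text \<open>The centroid of \<open>N\<close> is the average of the candidate centroids of its
  subsets of size \<open>n - t\<close>. Scaling \<open>v\<close> by \<open>1 / k\<close> turns sums
  into these candidates.\<close>

lemma centroid_in_ball:
  fixes v :: "nat \<Rightarrow> 'a::euclidean_space"
  assumes "finite M" "N \<subseteq> M" "n - t \<le> card N" "0 < n - t"
    and ball: "candidate_centroids n t M v \<subseteq> cball c r"
  shows "dist c (centroid v N) \<le> r"
proof -
  define k where "k = n - t"
  have k0: "0 < real k" using assms(4) by (simp add: k_def)
  have "(real k / real (card N)) *\<^sub>R sum (\<lambda>i. (1 / real k) *\<^sub>R v i) N \<in> cball c r"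
  proof (rule scaled_sum_in_convex)
    fix I assume "I \<subseteq> N" "card I = k"
    then have "centroid v I \<in> cball c r"
      using assms(2) by (intro subsetD[OF ball]) (auto simp: candidate_centroids_def k_def)
    then show "(\<Sum>i\<in>I. (1 / real k) *\<^sub>R v i) \<in> cball c r"
      using \<open>card I = k\<close> by (simp add: centroid_def scaleR_sum_right)
  qed (use assms finite_subset in \<open>auto simp: k_def\<close>)
  also have "(real k / real (card N)) *\<^sub>R sum (\<lambda>i. (1 / real k) *\<^sub>R v i) N = centroid v N"
    using k0 by (simp add: centroid_def scaleR_sum_right[symmetric])
  finally show ?thesis
    by simp
qed

text \<open>Closedness is what makes \<open>closest_point\<close> attain the minimal
  distance.\<close>

lemma closed_safe_area:
  fixes v :: "nat \<Rightarrow> 'a::euclidean_space"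
  assumes "finite M"
  shows "closed (safe_area n t M v)"
  unfolding safe_area_def
proof (intro closed_INT ballI finite_imp_compact_convex_hull[THEN compact_imp_closed] finite_imageI)
  show "finite I" if "I \<in> {I. I \<subseteq> M \<and> card I = n - t}" for I
    using that assms finite_subset by blast
qed

theorem lemma3p12:
  fixes n t :: nat
  assumes "n \<ge> 1"
    and "n > max 3 (CARD('d) + 1) * t"
  shows "computes_centroid_approximation n t (2 * real CARD('d))
           (safe_area_algorithm n t :: (real ^ 'd) aggregation)"
  unfolding computes_centroid_approximation_def
proof (intro allI impI)
  fix M N and v :: "nat \<Rightarrow> real ^ 'd"
  assume "configuration n t M v N"
  then have M: "M \<subseteq> {1..n}" "n - t \<le> card M" "card M \<le> n" and N: "N \<subseteq> M" "n - t \<le> card N"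
    by (auto simp: configuration_def received_family_def)
  have finM: "finite M"
    using M(1) finite_subset by blast
  let ?S = "candidate_centroids n t M v"
  let ?c = "covering_center ?S"
  let ?r = "covering_radius ?S"
  define s where "s = card M - (n - t)"
  have "(CARD('d) + 1) * t \<le> max 3 (CARD('d) + 1) * t"
    by (rule mult_right_mono) auto
  then have dt: "CARD('d) * t + t < n"
    using assms(2) unfolding add_mult_distrib mult_1 by linarith
  \<comment> \<open>At most \<open>n\<close> vectors are received, so at most \<open>t\<close> are
    in excess of \<open>n - t\<close>; hence \<open>(d + 1) * t < n\<close> yields
    \<open>d * s < n - t\<close>.\<close>
  have "s \<le> t"
    using M by (simp add: s_def)
  then have "CARD('d) * s \<le> CARD('d) * t"
    by (rule mult_left_mono) simp
  then have "CARD('d) * s < n - t"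
    using dt by linarith
  then have ks: "DIM(real ^ 'd) * s < n - t"
    by simp
  have cardM: "card M = (n - t) + s"
    using M by (simp add: s_def)
  have "?S = centroid v ` {I. I \<subseteq> M \<and> card I = n - t}"
    by (auto simp: candidate_centroids_def)
  then have "finite ?S"
    using finM by simp
  moreover have "?S \<noteq> {}"
    using obtain_subset_with_card_n[OF M(2)] by (auto simp: candidate_centroids_def)
  ultimately have "is_min_covering_ball ?S ?c ?r"
    by (intro is_min_covering_ball_covering finite_imp_bounded)
  then have ball: "?S \<subseteq> cball ?c ?r"
    by (simp add: is_min_covering_ball_def)
  obtain x where x: "x \<in> safe_area n t M v" "dist ?c x \<le> (2 * real CARD('d) - 1) * ?r"
    using safe_area_point_near_center[OF finM cardM ks refl ball] by auto
  \<comment> \<open>The output is no farther from the centre than \<open>x\<close>, which accounts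
    for \<open>2 d - 1\<close> radii; the true centroid adds one more.\<close>
  have "dist ?c (safe_area_algorithm n t M v) \<le> dist ?c x"
    unfolding safe_area_algorithm_def by (intro closest_point_le closed_safe_area finM x(1))
  moreover have "dist ?c (centroid v N) \<le> ?r"
    using dt by (intro centroid_in_ball[OF finM N _ ball]) simp
  ultimately have "dist (safe_area_algorithm n t M v) (centroid v N)
      \<le> (2 * real CARD('d) - 1) * ?r + ?r"
    using x(2) dist_triangle3[of "safe_area_algorithm n t M v" "centroid v N" ?c] by linarith
  then show "dist (safe_area_algorithm n t M v) (centroid v N) \<le> 2 * real CARD('d) * ?r"
    by (simp add: algebra_simps)
qed

end
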